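(* For all integers $q \ge d \ge c \ge 1$, $B(q,d,c) \le p(q,d,c)$, where $p(q,d,c)$ is the smallest prime number that is at least $\left\lceil \frac{q-c+1}{d-c+1}\right\rceil$. That is, every $f:\binom{[q]}{d}\to[c]$ has a $p(q,d,c)$-cover.
   Context: $\binom{[q]}{d}$ denotes the family of $d$-element subsets of $[q]=\{1,\dots,q\}$. A function $f:\binom{[q]}{d}\to[c]$ has a $t$-cover if there exist $S_1,\dots,S_t\in\binom{[q]}{d}$ (not necessarily distinct) with $S_1\cup\dots\cup S_t=[q]$ and $f(S_1)=\dots=f(S_t)$. $B(q,d,c)$ is the minimum $t$ such that every $f:\binom{[q]}{d}\to[c]$ has a $t$-cover. *)

theory Defs
  imports Complex_Main "HOL-Computational_Algebra.Primes"
begin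

definition dsubsets :: "nat \<Rightarrow> nat \<Rightarrow> nat set set" where
  "dsubsets q d = {S. S \<subseteq> {1..q} \<and> card S = d}"

definition has_cover :: "nat \<Rightarrow> nat \<Rightarrow> (nat set \<Rightarrow> nat) \<Rightarrow> nat \<Rightarrow> bool" where
  "has_cover q d f t \<longleftrightarrow>
     (\<exists>S :: nat \<Rightarrow> nat set. (\<forall>i\<in>{1..t}. S i \<in> dsubsets q d) \<and>
        (\<Union>i\<in>{1..t}. S i) = {1..q} \<and>
        (\<forall>i\<in>{1..t}. \<forall>j\<in>{1..t}. f (S i) = f (S j)))"

definition B :: "nat \<Rightarrow> nat \<Rightarrow> nat \<Rightarrow> nat" where
  "B q d c = (LEAST t. \<forall>f. (\<forall>S\<in>dsubsets q d. f S \<in> {1..c}) \<longrightarrow> has_cover q d f t)"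

definition p :: "nat \<Rightarrow> nat \<Rightarrow> nat \<Rightarrow> nat" where
  "p q d c = (LEAST r. prime r \<and>
      real r \<ge> real_of_int (ceiling ((real q - real c + 1) / (real d - real c + 1))))"

end

theory Submission
  imports Defs "HOL-Number_Theory.Residues"
begin

text \<open>
  Write \<open>r = p q d c\<close> and pass to complements: a cover by \<open>r\<close> sets is a family of \<open>r\<close> sets of size
  \<open>k = q - d\<close> with empty common intersection. Suppose that none of them is monochromatic. The proof
  is in the style of Sarkaria: a simplex of the \<open>q * (r - 1)\<close>-fold join of the discrete space
  \<open>\<int>/r\<close> has \<open>r - 1\<close> coordinates for each point of \<open>{1..q}\<close>, and so defines sets
  \<open>A\<^sub>0, \<dots>, A\<^bsub>r-1\<^esub>\<close> with empty common intersection. If no \<open>A\<^sub>g\<close> contains a set of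
  size \<open>k\<close>, then the \<open>A\<^sub>g\<close> have total size at most \<open>r * (k - 1)\<close>. Otherwise the pairs
  (colour, \<open>g\<close>) such that \<open>A\<^sub>g\<close> contains a \<open>k\<close>-set of that colour form a nonempty set, and
  for each colour some \<open>g\<close> is missing, so there are at most \<open>c * (r - 1)\<close> pairs. Recording these
  sizes together with an equivariant sign (this uses that \<open>r\<close> is prime) gives an equivariant monotone
  map from the face poset to an ordinal sum of \<open>r * (k - 1) + c * (r - 1) < q * (r - 1)\<close> copies
  of the antichain \<open>\<int>/r\<close>.

  Such a map does not exist, by a mod \<open>r\<close> form of Dold's theorem. In the source there are chains
  \<open>h\<^sub>0, h\<^sub>1, \<dots>\<close>, each obtained by coning off the previous one, with boundaries alternately
  \<open>(\<nu> - 1) h\<close> and \<open>(1 + \<nu> + \<dots> + \<nu>\<^bsup>r-1\<^esup>) h\<close> for the generator \<open>\<nu>\<close> of \<open>\<int>/r\<close>. In the target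
  there are cochains, dual to them, that evaluate to \<open>1\<close> modulo \<open>r\<close> on the images of these chains,
  but vanish for dimension reasons.
\<close>

section \<open>Cochains on lists\<close>

text \<open>A list of length \<open>n + 1\<close> is an \<open>n\<close>-simplex; the empty list accounts for the augmentation.\<close>

fun coboundary :: "('a list \<Rightarrow> 'b::ab_group_add) \<Rightarrow> 'a list \<Rightarrow> 'b" where
  "coboundary \<psi> [] = 0"
| "coboundary \<psi> (x # xs) = \<psi> xs - coboundary (\<lambda>l. \<psi> (x # l)) xs"

fun prism :: "('a \<Rightarrow> 'a) \<Rightarrow> ('a list \<Rightarrow> 'b::ab_group_add) \<Rightarrow> 'a list \<Rightarrow> 'b" where
  "prism f \<psi> [] = 0"
| "prism f \<psi> (x # xs) = \<psi> (x # f x # map f xs) - prism f (\<lambda>l. \<psi> (x # l)) xs"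

text \<open>In a poset in which \<open>f x\<close> lies above both \<open>x\<close> and \<open>z\<close>, the simplex \<open>xs\<close> is moved to \<open>map f xs\<close>
  by the prism and then coned off from \<open>z\<close>.\<close>

definition cone :: "('a \<Rightarrow> 'a) \<Rightarrow> 'a \<Rightarrow> ('a list \<Rightarrow> 'b::ab_group_add) \<Rightarrow> 'a list \<Rightarrow> 'b" where
  "cone f z \<psi> xs = \<psi> (z # map f xs) - prism f \<psi> xs"

lemma coboundary_diff: "coboundary (\<lambda>l. \<psi> l - \<phi> l) xs = coboundary \<psi> xs - coboundary \<phi> xs"
  by (induction xs arbitrary: \<psi> \<phi>) auto

lemma coboundary_zero: "coboundary (\<lambda>l. 0) xs = 0"
  by (induction xs) auto

lemma coboundary_sum: "coboundary (\<lambda>l. \<Sum>j\<in>J. \<psi> j l) xs = (\<Sum>j\<in>J. coboundary (\<psi> j) xs)"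
  by (induction xs arbitrary: \<psi>) (auto simp: sum_subtractf)

lemma coboundary_map: "coboundary (\<lambda>l. \<psi> (map f l)) xs = coboundary \<psi> (map f xs)"
  by (induction xs arbitrary: \<psi>) (auto simp: o_def)

lemma coboundary_coboundary: "coboundary (coboundary \<psi>) xs = 0"
  by (induction xs arbitrary: \<psi>) (auto simp: coboundary_diff)

lemma dvd_coboundary:
  fixes \<psi> :: "'a list \<Rightarrow> 'b::comm_ring_1"
  assumes "\<And>l. set l \<subseteq> set xs \<Longrightarrow> m dvd \<psi> l"
  shows "m dvd coboundary \<psi> xs"
  using assms
proof (induction xs arbitrary: \<psi>)
  case (Cons x xs)
  have "m dvd \<psi> xs" by (rule Cons.prems) auto
  moreover have "m dvd coboundary (\<lambda>l. \<psi> (x # l)) xs" by (rule Cons.IH, rule Cons.prems) auto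
  ultimately show ?case by simp
qed simp

lemma coboundary_eq_0_if_not_distinct_adj:
  assumes "\<And>l. \<not> distinct_adj l \<Longrightarrow> \<psi> l = 0" and "\<not> distinct_adj xs"
  shows "coboundary \<psi> xs = 0"
  using assms
proof (induction xs arbitrary: \<psi>)
  case (Cons x xs)
  then obtain y ys where xs: "xs = y # ys" by (cases xs) auto
  show ?case
  proof (cases "x = y")
    case True
    then have "(\<lambda>l. \<psi> (x # y # l)) = (\<lambda>l. 0)" by (intro ext Cons.prems(1)) simp
    then show ?thesis using True by (simp add: xs coboundary_zero)
  next
    case False
    then have "\<not> distinct_adj xs" using Cons.prems(2) xs by simp
    moreover from this have "coboundary (\<lambda>l. \<psi> (x # l)) xs = 0"
      by (intro Cons.IH) (metis Cons.prems(1) distinct_adj_ConsD)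
    ultimately show ?thesis using Cons.prems(1) by simp
  qed
qed simp

lemma prism_diff: "prism f (\<lambda>l. \<psi> l - \<phi> l) xs = prism f \<psi> xs - prism f \<phi> xs"
  by (induction xs arbitrary: \<psi> \<phi>) auto

lemma prism_homotopy:
  "prism f (coboundary \<psi>) xs + coboundary (prism f \<psi>) xs = \<psi> (map f xs) - \<psi> xs"
proof (induction xs arbitrary: \<psi>)
  case (Cons x xs)
  have "coboundary (\<lambda>l. \<psi> (x # f x # map f l)) xs = coboundary (\<lambda>l. \<psi> (x # f x # l)) (map f xs)"
    by (rule coboundary_map)
  then show ?case using Cons.IH[of "\<lambda>l. \<psi> (x # l)"]
    by (simp add: coboundary_diff prism_diff algebra_simps)
qed simp

lemma dvd_prism:
  fixes \<psi> :: "'a list \<Rightarrow> 'b::comm_ring_1"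
  assumes "\<And>us x vs. xs = us @ x # vs \<Longrightarrow> m dvd \<psi> (us @ x # f x # map f vs)"
  shows "m dvd prism f \<psi> xs"
  using assms
proof (induction xs arbitrary: \<psi>)
  case (Cons x xs)
  have "m dvd \<psi> (x # f x # map f xs)" using Cons.prems[of "[]"] by simp
  moreover have "m dvd prism f (\<lambda>l. \<psi> (x # l)) xs"
  proof (rule Cons.IH)
    show "m dvd \<psi> (x # us @ y # f y # map f vs)" if "xs = us @ y # vs" for us y vs
      using Cons.prems[of "x # us"] that by simp
  qed
  ultimately show ?case by simp
qed simp

lemma cone_diff: "cone f z (\<lambda>l. \<psi> l - \<phi> l) xs = cone f z \<psi> xs - cone f z \<phi> xs"
  by (simp add: cone_def prism_diff)

lemma cone_coboundary: "cone f z (coboundary \<psi>) xs = \<psi> xs - coboundary (cone f z \<psi>) xs"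
  using prism_homotopy[of f \<psi> xs] coboundary_map[of "\<lambda>l. \<psi> (z # l)" f xs]
  unfolding cone_def by (simp add: coboundary_diff algebra_simps)

section \<open>The periodic resolution of a cyclic group\<close>

definition cyclic_diff ::
    "('a \<Rightarrow> 'a) \<Rightarrow> nat \<Rightarrow> nat \<Rightarrow> ('a list \<Rightarrow> 'b::ab_group_add) \<Rightarrow> 'a list \<Rightarrow> 'b" where
  "cyclic_diff \<nu> r n \<psi> l =
    (if odd n then \<psi> (map \<nu> l) - \<psi> l else (\<Sum>j<r. \<psi> (map (\<nu> ^^ j) l)))"

lemma cyclic_diff_diff:
  "cyclic_diff \<nu> r n (\<lambda>l. \<psi> l - \<phi> l) xs = cyclic_diff \<nu> r n \<psi> xs - cyclic_diff \<nu> r n \<phi> xs"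
  by (auto simp: cyclic_diff_def sum_subtractf)

lemma dvd_cyclic_diff:
  fixes \<psi> :: "'a list \<Rightarrow> 'b::comm_ring_1"
  assumes "\<And>j. m dvd \<psi> (map (\<nu> ^^ j) l)"
  shows "m dvd cyclic_diff \<nu> r n \<psi> l"
  using assms[of 0] assms[of 1] assms by (auto simp: cyclic_diff_def intro: dvd_sum)

lemma coboundary_cyclic_diff:
  "coboundary (cyclic_diff \<nu> r n \<psi>) xs = cyclic_diff \<nu> r n (coboundary \<psi>) xs"
  by (cases "odd n")
    (simp_all add: cyclic_diff_def[abs_def] coboundary_diff coboundary_sum coboundary_map)

lemma cyclic_diff_cyclic_diff:
  assumes "map (\<nu> ^^ r) l = l"
  shows "cyclic_diff \<nu> r n (cyclic_diff \<nu> r (Suc n) \<psi>) l = 0"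
proof -
  have "(\<Sum>j<r. \<psi> (map (\<nu> ^^ Suc j) l) - \<psi> (map (\<nu> ^^ j) l)) = 0"
    by (subst sum_lessThan_telescope) (simp add: assms)
  moreover have "(\<nu> ^^ j) \<circ> \<nu> = \<nu> ^^ Suc j" "\<nu> \<circ> (\<nu> ^^ j) = \<nu> ^^ Suc j" for j
    by (simp only: funpow_Suc_right) simp
  ultimately show ?thesis by (simp add: cyclic_diff_def sum_subtractf del: funpow.simps)
qed

definition rot :: "nat \<Rightarrow> 'a \<times> nat \<Rightarrow> 'a \<times> nat" where
  "rot r = map_prod id (\<lambda>g. Suc g mod r)"

lemma rot_Pair [simp]: "rot r (e, g) = (e, Suc g mod r)"
  by (simp add: rot_def)

lemma fst_rot [simp]: "fst (rot r x) = fst x"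
  by (simp add: rot_def)

lemma snd_rot [simp]: "snd (rot r x) = Suc (snd x) mod r"
  by (simp add: rot_def)

lemma rot_funpow: "g < r \<Longrightarrow> (rot r ^^ j) (e, g) = (e, (g + j) mod r)"
  by (induction j) (auto simp: mod_Suc_eq)

lemma bij_betw_Suc_mod: "bij_betw (\<lambda>g. Suc g mod r) {..<r} {..<r}"
proof (rule bij_betw_imageI)
  show inj: "inj_on (\<lambda>g. Suc g mod r) {..<r}"
    by (rule inj_onI) (auto simp: mod_Suc split: if_splits)
  have "(\<lambda>g. Suc g mod r) ` {..<r} \<subseteq> {..<r}" by (cases r) auto
  then show "(\<lambda>g. Suc g mod r) ` {..<r} = {..<r}" using inj by (intro endo_inj_surj) auto
qed

lemma bij_betw_rot: "bij_betw (rot r) (X \<times> {..<r}) (X \<times> {..<r})"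
  unfolding rot_def by (intro bij_betw_map_prod bij_betw_id bij_betw_Suc_mod)

lemma inj_on_rot: "inj_on (rot r) (X \<times> {..<r})"
  using bij_betw_rot by (rule bij_betw_imp_inj_on)

lemma rot_period: "x \<in> X \<times> {..<r} \<Longrightarrow> (rot r ^^ r) x = x"
  by (cases x) (auto simp: rot_funpow)

lemma rot_funpow_in: "x \<in> X \<times> {..<r} \<Longrightarrow> (rot r ^^ j) x \<in> X \<times> {..<r}"
  by (cases x) (auto simp: rot_funpow)

section \<open>The obstruction cochains\<close>

text \<open>The resolution is exact, also modulo \<open>r\<close>: a preimage under \<open>cyclic_diff\<close> is found by using
  the first entry of a list to single out one list in each orbit.\<close>

definition cyclic_primitive ::
    "nat \<Rightarrow> nat \<Rightarrow> (('a \<times> nat) list \<Rightarrow> int) \<Rightarrow> ('a \<times> nat) list \<Rightarrow> int" where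
  "cyclic_primitive r n \<psi> l =
    (if odd n then - (\<Sum>j<r - snd (hd l). \<psi> (map (rot r ^^ j) l))
     else if snd (hd l) = 0 then \<psi> l else 0)"

lemma dvd_cyclic_diff_cyclic_primitive_odd:
  assumes "l \<noteq> []" and labels: "set l \<subseteq> UNIV \<times> {..<r}" and "odd n"
    and norm_cocycle: "m dvd (\<Sum>j<r. \<psi> (map (rot r ^^ j) l))"
  shows "m dvd cyclic_diff (rot r) r n (cyclic_primitive r n \<psi>) l - \<psi> l"
proof -
  define s where "s j = \<psi> (map (rot r ^^ j) l)" for j
  define g where "g = snd (hd l)"
  have g: "g < r" using assms(1) labels by (cases l) (auto simp: g_def)
  have "map (rot r ^^ j) (map (rot r) l) = map (rot r ^^ Suc j) l" for j
    by (simp only: map_map funpow_Suc_right)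
  moreover have "snd (hd (map (rot r) l)) = Suc g mod r"
    using assms(1) by (simp add: hd_map g_def)
  ultimately have diff: "cyclic_diff (rot r) r n (cyclic_primitive r n \<psi>) l =
      (\<Sum>j<r - g. s j) - (\<Sum>j<r - Suc g mod r. s (Suc j))"
    using assms(3) by (simp add: cyclic_diff_def cyclic_primitive_def s_def g_def del: map_map)
  have s_0: "s 0 = \<psi> l" by (simp add: s_def)
  show ?thesis
  proof (cases "Suc g < r")
    case True
    then have "r - g = Suc (r - Suc g)" by simp
    then have "(\<Sum>j<r - g. s j) = s 0 + (\<Sum>j<r - Suc g. s (Suc j))"
      by (simp only: sum.lessThan_Suc_shift)
    then show ?thesis using True by (simp add: diff s_0)
  next
    case False
    then have r: "r = Suc g" using g by simp
    have "map (rot r ^^ r) l = l" using labels by (intro map_idI) (blast intro: rot_period)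
    then have "s r = s 0" by (simp add: s_def)
    moreover have "s 0 + (\<Sum>j<r. s (Suc j)) = (\<Sum>j<r. s j) + s r"
      by (simp flip: sum.lessThan_Suc_shift)
    ultimately have "m dvd - (\<Sum>j<r. s (Suc j))" using norm_cocycle by (simp add: s_def)
    then show ?thesis unfolding diff by (simp add: r s_0 del: sum.lessThan_Suc)
  qed
qed

lemma dvd_cyclic_diff_cyclic_primitive_even:
  assumes "l \<noteq> []" and labels: "set l \<subseteq> UNIV \<times> {..<r}" and "even n"
    and invariant: "\<And>k. set k \<subseteq> UNIV \<times> {..<r} \<Longrightarrow> m dvd \<psi> (map (rot r) k) - \<psi> k"
  shows "m dvd cyclic_diff (rot r) r n (cyclic_primitive r n \<psi>) l - \<psi> l"
proof -
  define g where "g = snd (hd l)"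
  have g: "g < r" using assms(1) labels by (cases l) (auto simp: g_def)
  have "snd (hd (map (rot r ^^ j) l)) = (g + j) mod r" for j
    using assms(1) labels by (cases l) (auto simp: g_def rot_funpow)
  then have "cyclic_diff (rot r) r n (cyclic_primitive r n \<psi>) l =
      (\<Sum>j<r. if (g + j) mod r = 0 then \<psi> (map (rot r ^^ j) l) else 0)"
    using assms(3) by (simp add: cyclic_diff_def cyclic_primitive_def)
  also have "\<dots> = (\<Sum>j<r. if j = (r - g) mod r then \<psi> (map (rot r ^^ j) l) else 0)"
  proof (intro sum.cong refl)
    fix j assume "j \<in> {..<r}"
    then have "(g + j) mod r = 0 \<longleftrightarrow> j = (r - g) mod r"
      using g by (cases "g = 0") (auto simp: mod_if)
    then show "(if (g + j) mod r = 0 then \<psi> (map (rot r ^^ j) l) else 0) =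
        (if j = (r - g) mod r then \<psi> (map (rot r ^^ j) l) else 0)" by simp
  qed
  also have "\<dots> = \<psi> (map (rot r ^^ ((r - g) mod r)) l)" using g by simp
  finally have "cyclic_diff (rot r) r n (cyclic_primitive r n \<psi>) l =
      \<psi> (map (rot r ^^ ((r - g) mod r)) l)" .
  moreover have "m dvd \<psi> (map (rot r ^^ j) l) - \<psi> l" for j
  proof (induction j)
    case (Suc j)
    have "set (map (rot r ^^ j) l) \<subseteq> UNIV \<times> {..<r}"
      using labels rot_funpow_in unfolding set_map image_subset_iff by blast
    then have "m dvd \<psi> (map (rot r) (map (rot r ^^ j) l)) - \<psi> (map (rot r ^^ j) l)"
      by (rule invariant)
    from dvd_add[OF this Suc] show ?case by (simp add: comp_def)
  qed simp
  ultimately show ?thesis by simp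
qed

lemma dvd_cyclic_diff_cyclic_primitive:
  assumes labels: "set l \<subseteq> UNIV \<times> {..<r}" and "int r dvd \<psi> []"
    and cocycle: "\<And>k. set k \<subseteq> UNIV \<times> {..<r} \<Longrightarrow> int r dvd cyclic_diff (rot r) r n \<psi> k"
  shows "int r dvd cyclic_diff (rot r) r (Suc n) (cyclic_primitive r (Suc n) \<psi>) l - \<psi> l"
proof (cases "l = []")
  case True
  then show ?thesis using assms(2) by (simp add: cyclic_diff_def)
next
  case False
  show ?thesis
  proof (cases "odd n")
    case True
    then show ?thesis using cocycle False labels
      by (intro dvd_cyclic_diff_cyclic_primitive_even) (simp_all add: cyclic_diff_def)
  next
    case even: False
    then show ?thesis using cocycle[OF labels] False labels
      by (intro dvd_cyclic_diff_cyclic_primitive_odd) (simp_all add: cyclic_diff_def)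
  qed
qed

fun obstruction :: "nat \<Rightarrow> nat \<Rightarrow> ('a \<times> nat) list \<Rightarrow> int" where
  "obstruction r 0 = (\<lambda>l. of_bool (length l = 1))"
| "obstruction r (Suc n) = coboundary (cyclic_primitive r (Suc n) (obstruction r n))"

lemma coboundary_obstruction: "coboundary (obstruction r n) xs = 0"
proof (cases n)
  case 0
  have "obstruction r 0 l = coboundary (\<lambda>l. of_bool (l = [])) l" for l :: "('a \<times> nat) list"
    by (cases l) (auto simp: coboundary_zero)
  then have "obstruction r 0 = coboundary (\<lambda>l :: ('a \<times> nat) list. of_bool (l = []))" by blast
  then show ?thesis using 0 by (simp only: coboundary_coboundary)
qed (simp add: coboundary_coboundary)

lemma obstruction_Nil [simp]: "obstruction r n [] = 0"
  by (cases n) simp_all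

lemma dvd_cyclic_diff_obstruction:
  assumes "set l \<subseteq> UNIV \<times> {..<r}"
  shows "int r dvd cyclic_diff (rot r) r n (obstruction r n) l"
  using assms
proof (induction n arbitrary: l)
  case 0
  then show ?case by (simp add: cyclic_diff_def)
next
  case (Suc n)
  let ?\<psi> = "cyclic_diff (rot r) r (Suc n) (cyclic_primitive r (Suc n) (obstruction r n))"
  have "int r dvd coboundary (\<lambda>k. ?\<psi> k - obstruction r n k) l"
  proof (rule dvd_coboundary)
    fix k assume "set k \<subseteq> set l"
    then show "int r dvd ?\<psi> k - obstruction r n k"
      using Suc by (intro dvd_cyclic_diff_cyclic_primitive) auto
  qed
  then show ?case by (simp add: coboundary_diff coboundary_obstruction coboundary_cyclic_diff)
qed

lemma dvd_cyclic_diff_primitive_obstruction: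
  assumes "set l \<subseteq> UNIV \<times> {..<r}"
  shows "int r dvd cyclic_diff (rot r) r (Suc n) (cyclic_primitive r (Suc n) (obstruction r n)) l
    - obstruction r n l"
  using assms by (intro dvd_cyclic_diff_cyclic_primitive dvd_cyclic_diff_obstruction) simp_all

lemma obstruction_eq_0_if_not_distinct_adj:
  fixes l :: "('a \<times> nat) list"
  assumes "\<not> distinct_adj l"
  shows "obstruction r n l = 0"
  using assms
proof (induction n arbitrary: l)
  case 0
  then show ?case by (cases l; cases "tl l") auto
next
  case (Suc n)
  have "cyclic_primitive r (Suc n) (obstruction r n) k = 0" if "\<not> distinct_adj k"
    for k :: "('a \<times> nat) list"
  proof -
    have "obstruction r n (map f k) = 0" for f :: "'a \<times> nat \<Rightarrow> 'a \<times> nat"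
      by (rule Suc.IH) (use that distinct_adj_mapD in blast)
    from this this[of id] show ?thesis by (simp add: cyclic_primitive_def)
  qed
  then show ?case using Suc.prems by (auto intro: coboundary_eq_0_if_not_distinct_adj)
qed

section \<open>The join of copies of a cyclic group\<close>

text \<open>A face is a partial function from coordinates to group elements, given by its graph.\<close>

definition faces :: "nat \<Rightarrow> nat \<Rightarrow> (nat \<times> nat) set set" where
  "faces r n = {x. x \<noteq> {} \<and> x \<subseteq> {..<n} \<times> {..<r} \<and> inj_on fst x}"

definition chains :: "nat \<Rightarrow> nat \<Rightarrow> (nat \<times> nat) set list set" where
  "chains r n = {l. sorted_wrt (\<subseteq>) l \<and> length l = Suc n \<and> set l \<subseteq> faces r (Suc n)}"

lemma faces_mono: "m \<le> n \<Longrightarrow> faces r m \<subseteq> faces r n"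
  by (auto simp: faces_def)

lemma rot_faces:
  assumes "x \<in> faces r n" shows "rot r ` x \<in> faces r n"
proof -
  have "inj_on (fst \<circ> rot r) x" using assms by (simp add: faces_def comp_def)
  then have "inj_on fst (rot r ` x)" by (rule inj_on_imageI)
  moreover have "rot r ` x \<subseteq> {..<n} \<times> {..<r}"
    using assms bij_betw_imp_surj_on[OF bij_betw_rot, of r "{..<n}"] by (auto simp: faces_def)
  ultimately show ?thesis using assms by (simp add: faces_def)
qed

lemma image_funpow: "((`) f ^^ j) A = (f ^^ j) ` A" for f :: "'a \<Rightarrow> 'a"
  by (induction j) (auto simp: image_comp)

lemma rot_funpow_faces: "x \<in> faces r n \<Longrightarrow> ((`) (rot r) ^^ j) x \<in> faces r n"
  by (induction j) (auto intro: rot_faces)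

lemma rot_period_faces:
  assumes "x \<in> faces r n" shows "((`) (rot r) ^^ r) x = x"
proof -
  have "(rot r ^^ r) y = y" if "y \<in> x" for y
    by (rule rot_period[of _ UNIV]) (use that assms in \<open>auto simp: faces_def\<close>)
  then show ?thesis by (simp add: image_funpow)
qed

lemma rot_funpow_chains:
  assumes "l \<in> chains r n" shows "map ((`) (rot r) ^^ j) l \<in> chains r n"
proof -
  have "sorted_wrt (\<subseteq>) (map ((`) (rot r) ^^ j) l)"
    by (rule sorted_wrt_map_mono[of "(\<subseteq>)"])
      (use assms in \<open>auto simp: chains_def image_funpow\<close>)
  then show ?thesis using assms rot_funpow_faces by (fastforce simp: chains_def)
qed

lemma insert_faces: "x \<in> faces r n \<Longrightarrow> r > 0 \<Longrightarrow> insert (n, 0) x \<in> faces r (Suc n)"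
  by (auto simp: faces_def inj_on_def less_Suc_eq)

lemma singleton_faces: "r > 0 \<Longrightarrow> {(n, 0)} \<in> faces r (Suc n)"
  by (auto simp: faces_def)

lemma cone_chains:
  assumes "l \<in> chains r n" and "r > 0"
  shows "{(Suc n, 0)} # map (insert (Suc n, 0)) l \<in> chains r (Suc n)"
proof -
  have "sorted_wrt (\<subseteq>) (map (insert (Suc n, 0)) l)"
    by (rule sorted_wrt_map_mono[of "(\<subseteq>)"]) (use assms in \<open>auto simp: chains_def\<close>)
  then show ?thesis using assms
    by (auto simp: chains_def singleton_faces intro!: insert_faces)
qed

lemma prism_chains:
  assumes "us @ x # vs \<in> chains r n" and "r > 0"
  shows "us @ x # insert (Suc n, 0) x # map (insert (Suc n, 0)) vs \<in> chains r (Suc n)"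
proof -
  have "sorted_wrt (\<subseteq>) (map (insert (Suc n, 0)) vs)"
    by (rule sorted_wrt_map_mono[of "(\<subseteq>)"])
      (use assms in \<open>auto simp: chains_def sorted_wrt_append\<close>)
  moreover have "set (us @ x # vs) \<subseteq> faces r (Suc (Suc n))"
    using assms(1) faces_mono[of "Suc n" "Suc (Suc n)"] by (auto simp: chains_def)
  moreover have "u \<subseteq> insert (Suc n, 0) v" if "u \<in> set us" "v \<in> set vs" for u v
    using that assms(1) by (simp add: chains_def sorted_wrt_append subset_insertI2)
  ultimately show ?thesis using assms
    by (auto simp: chains_def sorted_wrt_append intro!: insert_faces)
qed

text \<open>\<open>hemisphere r n\<close> is the evaluation of cochains on the chain \<open>h\<^sub>n\<close>, the cone with apex \<open>(n, 0)\<close>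
  over the image of \<open>h\<^bsub>n-1\<^esub>\<close> under \<open>\<nu> - 1\<close> or \<open>1 + \<nu> + \<dots> + \<nu>\<^bsup>r-1\<^esup>\<close>.\<close>

fun hemisphere :: "nat \<Rightarrow> nat \<Rightarrow> ((nat \<times> nat) set list \<Rightarrow> 'b::ab_group_add) \<Rightarrow> 'b" where
  "hemisphere r 0 \<psi> = \<psi> [{(0, 0)}]"
| "hemisphere r (Suc n) \<psi> = hemisphere r n
    (cyclic_diff ((`) (rot r)) r (Suc n) (cone (insert (Suc n, 0)) {(Suc n, 0)} \<psi>))"

lemma hemisphere_diff: "hemisphere r n (\<lambda>l. \<psi> l - \<phi> l) = hemisphere r n \<psi> - hemisphere r n \<phi>"
proof (induction n arbitrary: \<psi> \<phi>)
  case (Suc n)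
  let ?C = "\<lambda>\<psi>. cyclic_diff ((`) (rot r)) r (Suc n) (cone (insert (Suc n, 0)) {(Suc n, 0)} \<psi>)"
  have "?C (\<lambda>l. \<psi> l - \<phi> l) = (\<lambda>l. ?C \<psi> l - ?C \<phi> l)"
    by (auto simp: cone_diff[abs_def] cyclic_diff_diff)
  then show ?case by (simp add: Suc.IH)
qed simp

lemma dvd_hemisphere:
  fixes \<psi> :: "(nat \<times> nat) set list \<Rightarrow> 'b::comm_ring_1"
  assumes "\<And>l. l \<in> chains r n \<Longrightarrow> m dvd \<psi> l" and "r > 0"
  shows "m dvd hemisphere r n \<psi>"
  using assms(1)
proof (induction n arbitrary: \<psi>)
  case 0
  then show ?case using assms(2) by (simp add: chains_def singleton_faces)
next
  case (Suc n)
  have "m dvd cone (insert (Suc n, 0)) {(Suc n, 0)} \<psi> l" if "l \<in> chains r n" for l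
    unfolding cone_def
    by (intro dvd_diff dvd_prism Suc.prems)
      (use that assms(2) in \<open>auto intro: cone_chains prism_chains\<close>)
  then show ?case by (auto intro: Suc.IH dvd_cyclic_diff rot_funpow_chains)
qed

lemma hemisphere_eq_0:
  fixes \<psi> :: "(nat \<times> nat) set list \<Rightarrow> 'b::comm_ring_1"
  assumes "\<And>l. l \<in> chains r n \<Longrightarrow> \<psi> l = 0" and "r > 0"
  shows "hemisphere r n \<psi> = 0"
  using dvd_hemisphere[of r n 0 \<psi>] assms by simp

lemma hemisphere_coboundary:
  fixes \<psi> :: "(nat \<times> nat) set list \<Rightarrow> 'b::comm_ring_1"
  assumes "r > 0"
  shows "hemisphere r (Suc n) (coboundary \<psi>) =
    hemisphere r n (cyclic_diff ((`) (rot r)) r (Suc n) \<psi>)"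
proof (induction n arbitrary: \<psi>)
  case 0
  show ?case by (simp add: cyclic_diff_def cone_def)
next
  case (Suc n)
  let ?D = "\<lambda>n. cyclic_diff ((`) (rot r)) r n"
  let ?cone = "cone (insert (Suc (Suc n), 0)) {(Suc (Suc n), 0)}"
  have boundary:
    "?D m (?cone (coboundary \<psi>)) = (\<lambda>l. ?D m \<psi> l - coboundary (?D m (?cone \<psi>)) l)" for m
    by (auto simp: cone_coboundary[abs_def] cyclic_diff_diff coboundary_cyclic_diff)
  have "hemisphere r (Suc n) (coboundary (?D (Suc (Suc n)) (?cone \<psi>))) =
      hemisphere r n (?D (Suc n) (?D (Suc (Suc n)) (?cone \<psi>)))"
    by (rule Suc.IH)
  also have "\<dots> = 0"
  proof (intro hemisphere_eq_0 cyclic_diff_cyclic_diff map_idI)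
    show "((`) (rot r) ^^ r) x = x" if "l \<in> chains r n" "x \<in> set l" for l x
      by (rule rot_period_faces[of x r "Suc n"]) (use that in \<open>auto simp: chains_def\<close>)
  qed (rule assms)
  finally show ?case
    by (subst hemisphere.simps) (simp only: boundary hemisphere_diff diff_zero)
qed

section \<open>Equivariant maps to an ordinal sum of antichains\<close>

locale equivariant_level_map =
  fixes r n :: nat and L :: "'l::linorder set" and f :: "(nat \<times> nat) set \<Rightarrow> 'l \<times> nat"
  assumes r_ge_2: "2 \<le> r"
    and finite_levels: "finite L"
    and range: "x \<in> faces r n \<Longrightarrow> f x \<in> L \<times> {..<r}"
    and equivariant: "x \<in> faces r n \<Longrightarrow> f (rot r ` x) = rot r (f x)"
    and monotone: "x \<in> faces r n \<Longrightarrow> y \<in> faces r n \<Longrightarrow> x \<subseteq> y \<Longrightarrow> f x = f y \<or> fst (f x) < fst (f y)"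
begin

lemma equivariant_funpow:
  assumes "x \<in> faces r n" shows "f (((`) (rot r) ^^ j) x) = (rot r ^^ j) (f x)"
  by (induction j) (simp_all add: equivariant rot_funpow_faces assms)

lemma chains_subset_faces: "k < n \<Longrightarrow> l \<in> chains r k \<Longrightarrow> set l \<subseteq> faces r n"
  using faces_mono[of "Suc k" n r] by (auto simp: chains_def)

lemma cyclic_diff_pullback:
  assumes "set l \<subseteq> faces r n"
  shows "cyclic_diff ((`) (rot r)) r k (\<lambda>l. \<psi> (map f l)) l = cyclic_diff (rot r) r k \<psi> (map f l)"
proof -
  have "map f (map ((`) (rot r) ^^ j) l) = map (rot r ^^ j) (map f l)" for j
    using assms equivariant_funpow by auto
  from this this[of 1] show ?thesis by (simp add: cyclic_diff_def del: map_map)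
qed

lemma hemisphere_obstruction:
  "k < n \<Longrightarrow> [hemisphere r k (\<lambda>l. obstruction r k (map f l)) = 1] (mod int r)"
proof (induction k)
  case (Suc k)
  let ?\<phi> = "cyclic_primitive r (Suc k) (obstruction r k)"
  let ?D = "cyclic_diff ((`) (rot r)) r (Suc k)"
  have "hemisphere r (Suc k) (\<lambda>l. obstruction r (Suc k) (map f l)) =
      hemisphere r k (?D (\<lambda>l. ?\<phi> (map f l)))"
    unfolding obstruction.simps coboundary_map[symmetric]
    by (rule hemisphere_coboundary) (use r_ge_2 in simp)
  moreover have "int r dvd hemisphere r k (\<lambda>l. ?D (\<lambda>l. ?\<phi> (map f l)) l - obstruction r k (map f l))"
  proof (rule dvd_hemisphere)
    fix l assume "l \<in> chains r k"
    then have l_faces: "set l \<subseteq> faces r n" using Suc.prems by (intro chains_subset_faces) simp_all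
    then have "set (map f l) \<subseteq> UNIV \<times> {..<r}" using range by fastforce
    then show "int r dvd ?D (\<lambda>l. ?\<phi> (map f l)) l - obstruction r k (map f l)"
      unfolding cyclic_diff_pullback[OF l_faces] by (rule dvd_cyclic_diff_primitive_obstruction)
  qed (use r_ge_2 in simp)
  ultimately have "[hemisphere r (Suc k) (\<lambda>l. obstruction r (Suc k) (map f l)) =
      hemisphere r k (\<lambda>l. obstruction r k (map f l))] (mod int r)"
    by (simp add: cong_iff_dvd_diff hemisphere_diff)
  then show ?case using Suc by (auto intro: cong_trans)
qed simp

lemma length_le_card_levels:
  assumes "sorted_wrt (\<subseteq>) l" and l_faces: "set l \<subseteq> faces r n" and "distinct_adj (map f l)"
  shows "length l \<le> card L"
proof -
  let ?level = "\<lambda>x. fst (f x)"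
  have "successively (\<lambda>x y. x \<subseteq> y \<and> f x \<noteq> f y) l"
    using assms(3) successively_if_sorted_wrt[OF assms(1)]
    by (auto simp: distinct_adj_def successively_map successively_conv_nth)
  then have "successively (\<lambda>x y. ?level x < ?level y) l"
    by (rule successively_mono) (use l_faces monotone in blast)
  then have "sorted_wrt (<) (map ?level l)"
    by (simp add: successively_map flip: successively_conv_sorted_wrt)
  then have "distinct (map ?level l)" by (simp add: strict_sorted_iff)
  then have "length l = card (set (map ?level l))" by (metis distinct_card length_map)
  also have "\<dots> \<le> card L"
    using l_faces range by (intro card_mono finite_levels) fastforce
  finally show ?thesis .
qed

theorem le_card_levels: "n \<le> card L"
proof (rule ccontr)
  assume "\<not> n \<le> card L"
  then have less: "card L < n" by simp
  have "hemisphere r (card L) (\<lambda>l. obstruction r (card L) (map f l)) = 0"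
  proof (intro hemisphere_eq_0 obstruction_eq_0_if_not_distinct_adj notI)
    fix l assume chain: "l \<in> chains r (card L)" and "distinct_adj (map f l)"
    then have "length l \<le> card L" using less
      by (intro length_le_card_levels chains_subset_faces) (auto simp: chains_def)
    then show False using chain by (simp add: chains_def)
  qed (use r_ge_2 in simp)
  then have "[0 = 1] (mod int r)" using hemisphere_obstruction[OF less] by simp
  then show False using r_ge_2 by (simp add: cong_def)
qed

end

section \<open>Equivariant signs\<close>

definition proper_fibres :: "nat \<Rightarrow> ('a \<times> nat) set \<Rightarrow> bool" where
  "proper_fibres r W \<longleftrightarrow> (\<forall>e. W `` {e} \<subset> {..<r})"

text \<open>By Fermat's theorem \<open>card F ^ (r - 2)\<close> is the inverse of \<open>card F\<close> modulo a prime \<open>r\<close>, so this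
  is the mean of \<open>F\<close> modulo \<open>r\<close>.\<close>

definition mean_mod :: "nat \<Rightarrow> nat set \<Rightarrow> nat" where
  "mean_mod r F = (\<Sum>F * card F ^ (r - 2)) mod r"

text \<open>The fibre is chosen in terms of \<open>Domain W\<close> only, which is invariant under \<open>rot r\<close>.\<close>

definition sign :: "nat \<Rightarrow> ('a \<times> nat) set \<Rightarrow> nat" where
  "sign r W = mean_mod r (W `` {SOME e. e \<in> Domain W})"

lemma sign_less: "r > 0 \<Longrightarrow> sign r W < r"
  by (simp add: sign_def mean_mod_def)

lemma mean_mod_Suc:
  assumes "prime r" and F_proper: "F \<subset> {..<r}" "F \<noteq> {}"
  shows "mean_mod r ((\<lambda>g. Suc g mod r) ` F) = Suc (mean_mod r F) mod r"
proof -
  have r_ge_2: "r \<ge> 2" using assms(1) by (rule prime_ge_2_nat)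
  have inj: "inj_on (\<lambda>g. Suc g mod r) F"
    using bij_betw_imp_inj_on[OF bij_betw_Suc_mod] by (rule inj_on_subset) (use F_proper in blast)
  have "card F < card {..<r}" using F_proper(1) by (intro psubset_card_mono) auto
  moreover have "card F > 0"
    using F_proper finite_subset[of F "{..<r}"] by (auto simp: card_gt_0_iff)
  ultimately have "\<not> r dvd card F" by (auto dest: dvd_imp_le)
  then have fermat: "[card F ^ (r - 1) = 1] (mod r)" by (rule fermat_theorem[OF assms(1)])
  have "[(\<Sum>g\<in>F. Suc g mod r) = (\<Sum>g\<in>F. Suc g)] (mod r)"
    by (rule cong_sum) (simp add: cong_def)
  then have "[\<Sum>((\<lambda>g. Suc g mod r) ` F) = \<Sum>F + card F] (mod r)"
    by (simp add: sum.reindex[OF inj] sum_Suc)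
  then have "[\<Sum>((\<lambda>g. Suc g mod r) ` F) * card F ^ (r - 2) =
      (\<Sum>F + card F) * card F ^ (r - 2)] (mod r)"
    by (rule cong_scalar_right)
  also have "(\<Sum>F + card F) * card F ^ (r - 2) = \<Sum>F * card F ^ (r - 2) + card F ^ (r - 1)"
    using r_ge_2 by (simp add: distrib_right numeral_2_eq_2 Suc_diff_Suc flip: power_Suc)
  also have "[\<dots> = \<Sum>F * card F ^ (r - 2) + 1] (mod r)"
    using fermat by (intro cong_add cong_refl)
  finally show ?thesis by (simp add: mean_mod_def card_image[OF inj] cong_def mod_Suc_eq)
qed

lemma Image_rot: "(rot r ` W) `` {e} = (\<lambda>g. Suc g mod r) ` (W `` {e})"
  by (force simp: rot_def)

lemma sign_rot:
  assumes "prime r" and "proper_fibres r W" and "W \<noteq> {}"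
  shows "sign r (rot r ` W) = Suc (sign r W) mod r"
proof -
  have "Domain (rot r ` W) = Domain W" by (simp add: Domain_fst image_image)
  moreover have "Domain W \<noteq> {}" using assms(3) by (simp add: Domain_empty_iff)
  then have "(SOME e. e \<in> Domain W) \<in> Domain W" by (simp add: some_in_eq)
  then have "W `` {SOME e. e \<in> Domain W} \<noteq> {}" by blast
  ultimately show ?thesis
    using mean_mod_Suc[OF assms(1)] assms(2) by (simp add: sign_def Image_rot proper_fibres_def)
qed

lemma card_rot: "W \<subseteq> X \<times> {..<r} \<Longrightarrow> card (rot r ` W) = card W"
  by (rule card_image[OF inj_on_subset[OF inj_on_rot]])

lemma card_le_if_card_Image_le:
  assumes "finite I" and "Domain W \<subseteq> I" and "\<And>e. e \<in> I \<Longrightarrow> card (W `` {e}) \<le> m"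
  shows "card W \<le> card I * m"
proof (cases "finite W")
  case True
  have "W = Sigma I (\<lambda>e. W `` {e})" using assms(2) by auto
  then have "card W = (\<Sum>e\<in>I. card (W `` {e}))"
    using assms(1) True by (metis card_SigmaI finite_Image)
  then show ?thesis using sum_bounded_above[of I, OF assms(3)] by simp
qed simp

lemma card_le_if_proper_fibres:
  assumes "proper_fibres r W" and "finite I" and "Domain W \<subseteq> I"
  shows "card W \<le> card I * (r - 1)"
proof (rule card_le_if_card_Image_le[OF assms(2,3)])
  fix e
  have "card (W `` {e}) < card {..<r}"
    using assms(1) by (intro psubset_card_mono) (auto simp: proper_fibres_def)
  then show "card (W `` {e}) \<le> r - 1" by simp
qed

lemma proper_fibres_map_prod_faces:
  assumes face: "x \<in> faces r n" and card_fibre_less: "\<And>e. card {i \<in> {..<n}. \<pi> i = e} < r"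
  shows "proper_fibres r (map_prod \<pi> id ` x)"
  unfolding proper_fibres_def
proof (intro allI psubsetI)
  fix e
  show "(map_prod \<pi> id ` x) `` {e} \<subseteq> {..<r}" using face by (auto simp: faces_def)
  let ?points = "{z \<in> x. \<pi> (fst z) = e}"
  have finite_points: "finite ?points"
    by (rule finite_subset[of _ "{..<n} \<times> {..<r}"]) (use face in \<open>auto simp: faces_def\<close>)
  have "(map_prod \<pi> id ` x) `` {e} \<subseteq> snd ` ?points" by (auto intro: rev_image_eqI)
  then have "card ((map_prod \<pi> id ` x) `` {e}) \<le> card ?points"
    by (rule surj_card_le[OF finite_points])
  also have "\<dots> = card (fst ` ?points)"
    by (rule card_image[symmetric], rule inj_on_subset[of fst x])
      (use face in \<open>auto simp: faces_def\<close>)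
  also have "\<dots> \<le> card {i \<in> {..<n}. \<pi> i = e}"
    using face by (intro card_mono) (auto simp: faces_def)
  also have "\<dots> < r" by (rule card_fibre_less)
  finally show "(map_prod \<pi> id ` x) `` {e} \<noteq> {..<r}" by auto
qed

lemma ex_map_card_fibres_le:
  assumes "finite X"
  shows "\<exists>\<pi>. \<pi> ` {..<card X * m} \<subseteq> X \<and> (\<forall>e. card {i \<in> {..<card X * m}. \<pi> i = e} \<le> m)"
proof -
  obtain h where h_bij: "bij_betw h {..<card X * m} (X \<times> {..<m})"
    using ex_bij_betw_nat_finite[of "X \<times> {..<m}"] assms by (auto simp: lessThan_atLeast0)
  have "card {i \<in> {..<card X * m}. fst (h i) = e} \<le> m" for e
  proof -
    have "card {i \<in> {..<card X * m}. fst (h i) = e} \<le> card ({e} \<times> {..<m})"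
    proof (rule card_inj_on_le)
      show "inj_on h {i \<in> {..<card X * m}. fst (h i) = e}"
        using bij_betw_imp_inj_on[OF h_bij] by (rule inj_on_subset) auto
      show "h ` {i \<in> {..<card X * m}. fst (h i) = e} \<subseteq> {e} \<times> {..<m}"
        using bij_betwE[OF h_bij] by (simp add: image_subset_iff mem_Times_iff)
    qed simp
    then show ?thesis by simp
  qed
  moreover have "(fst \<circ> h) ` {..<card X * m} \<subseteq> X"
    using bij_betwE[OF h_bij] by (auto simp: mem_Times_iff)
  ultimately show ?thesis by (intro exI[of _ "fst \<circ> h"]) simp
qed

section \<open>Colourings with intersecting colour classes\<close>

locale intersecting_colouring =
  fixes r k :: nat and E :: "'e set" and C :: "'c set" and colour :: "'e set \<Rightarrow> 'c"
  assumes prime_r: "prime r"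
    and finite_points: "finite E"
    and finite_colours: "finite C"
    and colour_in: "A \<subseteq> E \<Longrightarrow> card A = k \<Longrightarrow> colour A \<in> C"
    and intersecting:
      "(\<And>g. g < r \<Longrightarrow> F g \<subseteq> E \<and> card (F g) = k \<and> colour (F g) = a) \<Longrightarrow> (\<Inter>g<r. F g) \<noteq> {}"
begin

definition shadow :: "('e \<times> nat) set \<Rightarrow> ('c \<times> nat) set" where
  "shadow W = {(colour A, g) |A g. A \<subseteq> E \<and> card A = k \<and> g < r \<and> A \<times> {g} \<subseteq> W}"

text \<open>Sets with empty shadow have at most \<open>r * (k - 1)\<close> elements; the offset puts them below the
  others.\<close>

definition level_map :: "('e \<times> nat) set \<Rightarrow> nat \<times> nat" where
  "level_map W =
    (if shadow W = {} then (card W, sign r W)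
     else (r * (k - 1) + card (shadow W), sign r (shadow W)))"

lemma r_ge_2: "r \<ge> 2"
  using prime_r by (rule prime_ge_2_nat)

lemma k_pos: "k > 0"
proof (rule ccontr)
  assume "\<not> k > 0"
  then have "(\<Inter>g<r. {} :: 'e set) \<noteq> {}" by (intro intersecting[of _ "colour {}"]) simp
  then show False using r_ge_2 by (auto simp: lessThan_empty_iff split: if_splits)
qed

lemma shadow_mono: "W \<subseteq> W' \<Longrightarrow> shadow W \<subseteq> shadow W'"
  unfolding shadow_def by blast

lemma shadow_subset: "shadow W \<subseteq> C \<times> {..<r}"
  using colour_in by (auto simp: shadow_def)

lemma finite_shadow: "finite (shadow W)"
  using shadow_subset by (rule finite_subset) (simp add: finite_colours)

lemma shadow_rot:
  assumes "W \<subseteq> E \<times> {..<r}"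
  shows "shadow (rot r ` W) = rot r ` shadow W"
proof -
  have "(e, Suc g mod r) \<in> rot r ` W \<longleftrightarrow> (e, g) \<in> W" if "e \<in> E" "g < r" for e g
    using inj_on_image_mem_iff[OF inj_on_rot _ assms, of "(e, g)"] that by simp
  then have layer: "A \<times> {Suc g mod r} \<subseteq> rot r ` W \<longleftrightarrow> A \<times> {g} \<subseteq> W" if "A \<subseteq> E" "g < r" for A g
    using that by (auto simp: subset_iff)
  show ?thesis
  proof (intro equalityI subsetI)
    fix y assume "y \<in> shadow (rot r ` W)"
    then obtain A h where A_layer:
      "y = (colour A, h)" "A \<subseteq> E" "card A = k" "h < r" "A \<times> {h} \<subseteq> rot r ` W"
      by (auto simp: shadow_def)
    obtain g where g_shift: "g < r" "h = Suc g mod r"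
      using \<open>h < r\<close> bij_betw_imp_surj_on[OF bij_betw_Suc_mod[of r]] by blast
    then have "A \<times> {g} \<subseteq> W" using A_layer layer by blast
    then have "(colour A, g) \<in> shadow W" unfolding shadow_def using A_layer g_shift by blast
    then have "rot r (colour A, g) \<in> rot r ` shadow W" by (rule imageI)
    then show "y \<in> rot r ` shadow W" using A_layer(1) g_shift(2) by simp
  next
    fix y assume "y \<in> rot r ` shadow W"
    then obtain A g where A_layer:
      "y = (colour A, Suc g mod r)" "A \<subseteq> E" "card A = k" "g < r" "A \<times> {g} \<subseteq> W"
      by (auto simp: shadow_def)
    then have "A \<times> {Suc g mod r} \<subseteq> rot r ` W" "Suc g mod r < r" using layer r_ge_2 by simp_all
    then show "y \<in> shadow (rot r ` W)" unfolding shadow_def using A_layer by blast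
  qed
qed

lemma proper_fibres_shadow:
  assumes "proper_fibres r W"
  shows "proper_fibres r (shadow W)"
  unfolding proper_fibres_def
proof (intro allI psubsetI notI)
  show "shadow W `` {a} \<subseteq> {..<r}" for a using shadow_subset[of W] by blast
next
  fix a assume full: "shadow W `` {a} = {..<r}"
  have "\<exists>A. A \<subseteq> E \<and> card A = k \<and> colour A = a \<and> A \<times> {g} \<subseteq> W" if "g < r" for g
  proof -
    have "(a, g) \<in> shadow W" using full that by blast
    then show ?thesis by (auto simp: shadow_def)
  qed
  then obtain A where same_colour: "\<And>g. g < r \<Longrightarrow> A g \<subseteq> E \<and> card (A g) = k \<and> colour (A g) = a"
    and layer: "\<And>g. g < r \<Longrightarrow> A g \<times> {g} \<subseteq> W" by metis
  obtain e where "e \<in> (\<Inter>g<r. A g)" using intersecting[of A, OF same_colour] by blast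
  then have "{..<r} \<subseteq> W `` {e}" using layer by blast
  then show False using assms by (auto simp: proper_fibres_def)
qed

lemma card_le_if_shadow_empty:
  assumes points: "W \<subseteq> E \<times> {..<r}" and "shadow W = {}"
  shows "card W \<le> r * (k - 1)"
proof -
  have "card (W\<inverse> `` {g}) \<le> k - 1" if "g < r" for g
  proof (rule ccontr)
    assume "\<not> card (W\<inverse> `` {g}) \<le> k - 1"
    then have "k \<le> card (W\<inverse> `` {g})" by simp
    then obtain A where "A \<subseteq> W\<inverse> `` {g}" "card A = k" by (meson obtain_subset_with_card_n)
    then have "(colour A, g) \<in> shadow W" using points \<open>g < r\<close> unfolding shadow_def by blast
    then show False using assms(2) by simp
  qed
  then have "card (W\<inverse>) \<le> card {..<r} * (k - 1)"
    by (intro card_le_if_card_Image_le) (use points in auto)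
  then show ?thesis by simp
qed

lemma level_map_range:
  assumes "W \<subseteq> E \<times> {..<r}" and "W \<noteq> {}" and "proper_fibres r W"
  shows "level_map W \<in> {1..r * (k - 1) + card C * (r - 1)} \<times> {..<r}"
proof (cases "shadow W = {}")
  case True
  have "card W > 0"
    using assms(1,2) finite_subset[OF assms(1)] finite_points by (simp add: card_gt_0_iff)
  then show ?thesis
    using True card_le_if_shadow_empty[OF assms(1)] r_ge_2 by (simp add: level_map_def sign_less)
next
  case False
  have "card (shadow W) \<le> card C * (r - 1)"
    using shadow_subset
    by (intro card_le_if_proper_fibres proper_fibres_shadow assms(3) finite_colours) auto
  moreover have "card (shadow W) > 0" using False finite_shadow by (simp add: card_gt_0_iff)
  ultimately show ?thesis using False r_ge_2 by (simp add: level_map_def sign_less)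
qed

lemma level_map_rot:
  assumes "W \<subseteq> E \<times> {..<r}" and "W \<noteq> {}" and "proper_fibres r W"
  shows "level_map (rot r ` W) = rot r (level_map W)"
  using assms
  by (simp add: level_map_def shadow_rot card_rot[OF shadow_subset] card_rot[OF assms(1)]
      sign_rot[OF prime_r] proper_fibres_shadow)

lemma level_map_mono:
  assumes "W \<subseteq> W'" and points: "W' \<subseteq> E \<times> {..<r}"
  shows "level_map W = level_map W' \<or> fst (level_map W) < fst (level_map W')"
proof -
  have finite_W': "finite W'" using points by (rule finite_subset) (simp add: finite_points)
  consider (neither) "shadow W = {}" "shadow W' = {}"
    | (only_larger) "shadow W = {}" "shadow W' \<noteq> {}"
    | (both) "shadow W \<noteq> {}" "shadow W' \<noteq> {}"
    using shadow_mono[OF assms(1)] by blast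
  then show ?thesis
  proof cases
    case neither
    then show ?thesis using assms(1) psubset_card_mono[OF finite_W'] by (auto simp: level_map_def)
  next
    case only_larger
    have "card W \<le> r * (k - 1)" using only_larger assms by (intro card_le_if_shadow_empty) auto
    moreover have "card (shadow W') > 0"
      using only_larger finite_shadow by (simp add: card_gt_0_iff)
    ultimately show ?thesis using only_larger by (simp add: level_map_def)
  next
    case both
    have "shadow W = shadow W' \<or> card (shadow W) < card (shadow W')"
      using shadow_mono[OF assms(1)] psubset_card_mono[OF finite_shadow] by blast
    then show ?thesis using both by (auto simp: level_map_def)
  qed
qed

theorem card_points_le: "card E * (r - 1) + r \<le> r * k + card C * (r - 1)"
proof -
  define n where "n = card E * (r - 1)"
  obtain \<pi> where image_subset: "\<pi> ` {..<n} \<subseteq> E"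
    and card_fibre_le: "\<And>e. card {i \<in> {..<n}. \<pi> i = e} \<le> r - 1"
    unfolding n_def using ex_map_card_fibres_le[OF finite_points] by blast
  define collapse where "collapse = image (map_prod \<pi> (id :: nat \<Rightarrow> nat))"
  have subset: "collapse x \<subseteq> E \<times> {..<r}" if "x \<in> faces r n" for x
    using that image_subset by (auto simp: collapse_def faces_def)
  have nonempty: "collapse x \<noteq> {}" if "x \<in> faces r n" for x
    using that by (auto simp: collapse_def faces_def)
  have "card {i \<in> {..<n}. \<pi> i = e} < r" for e using card_fibre_le[of e] r_ge_2 by simp
  then have proper: "proper_fibres r (collapse x)" if "x \<in> faces r n" for x
    unfolding collapse_def using that by (intro proper_fibres_map_prod_faces)
  interpret equivariant_level_map r n "{1..r * (k - 1) + card C * (r - 1)}"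
    "\<lambda>x. level_map (collapse x)"
  proof
    fix x assume face: "x \<in> faces r n"
    show "level_map (collapse x) \<in> {1..r * (k - 1) + card C * (r - 1)} \<times> {..<r}"
      by (rule level_map_range[OF subset[OF face] nonempty[OF face] proper[OF face]])
    have "collapse (rot r ` x) = rot r ` collapse x"
      by (simp add: collapse_def rot_def image_image map_prod.compositionality comp_def)
    then show "level_map (collapse (rot r ` x)) = rot r (level_map (collapse x))"
      using level_map_rot[OF subset[OF face] nonempty[OF face] proper[OF face]] by simp
  next
    fix x y assume "y \<in> faces r n" "x \<subseteq> y"
    then show "level_map (collapse x) = level_map (collapse y) \<or>
        fst (level_map (collapse x)) < fst (level_map (collapse y))"
      by (intro level_map_mono subset) (auto simp: collapse_def)
  qed (simp_all add: r_ge_2)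
  have "n \<le> r * (k - 1) + card C * (r - 1)" using le_card_levels by simp
  moreover have "r * k = r * (k - 1) + r" using k_pos by (cases k) simp_all
  ultimately show ?thesis by (simp add: n_def)
qed

end

section \<open>Covers\<close>

lemma Diff_dsubsets:
  assumes "A \<in> dsubsets q (q - d)" and "d \<le> q"
  shows "{1..q} - A \<in> dsubsets q d"
proof -
  have "A \<subseteq> {1..q}" and "card A = q - d" using assms(1) by (auto simp: dsubsets_def)
  then have "card ({1..q} - A) = q - (q - d)"
    by (subst card_Diff_subset) (auto intro: finite_subset)
  then show ?thesis using assms(2) by (auto simp: dsubsets_def)
qed

lemma has_cover_if_Inter_empty:
  assumes "d \<le> q"
    and same_colour: "\<And>g. g < t \<Longrightarrow> A g \<in> dsubsets q (q - d) \<and> f ({1..q} - A g) = a"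
    and empty: "(\<Inter>g<t. A g) = {}"
  shows "has_cover q d f t"
  unfolding has_cover_def
proof (intro exI[of _ "\<lambda>i. {1..q} - A (i - 1)"] conjI ballI)
  have complements: "A (i - 1) \<in> dsubsets q (q - d) \<and> f ({1..q} - A (i - 1)) = a"
    if "i \<in> {1..t}" for i
    using that by (intro same_colour) auto
  show "{1..q} - A (i - 1) \<in> dsubsets q d" if "i \<in> {1..t}" for i
    using complements[OF that] assms(1) by (intro Diff_dsubsets) simp_all
  show "f ({1..q} - A (i - 1)) = f ({1..q} - A (j - 1))" if "i \<in> {1..t}" "j \<in> {1..t}" for i j
    using complements[OF that(1)] complements[OF that(2)] by simp
  have "(\<Union>i\<in>{1..t}. {1..q} - A (i - 1)) = (\<Union>i\<in>Suc ` {..<t}. {1..q} - A (i - 1))"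
    by (simp only: image_Suc_lessThan)
  also have "\<dots> = (\<Union>g<t. {1..q} - A g)" by simp
  also have "\<dots> = {1..q} - (\<Inter>g<t. A g)" using same_colour by auto
  finally show "(\<Union>i\<in>{1..t}. {1..q} - A (i - 1)) = {1..q}" unfolding empty by simp
qed

lemma has_cover_if_prime:
  assumes "prime r" and "c \<le> d" and "d \<le> q" and bound: "q < r * (d - c + 1) + c"
    and colours: "\<And>S. S \<in> dsubsets q d \<Longrightarrow> f S \<in> {1..c}"
  shows "has_cover q d f r"
proof (rule ccontr)
  assume no_cover: "\<not> has_cover q d f r"
  interpret intersecting_colouring r "q - d" "{1..q}" "{1..c}" "\<lambda>A. f ({1..q} - A)"
  proof
    fix A assume "A \<subseteq> {1..q}" and "card A = q - d"
    then show "f ({1..q} - A) \<in> {1..c}"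
      using assms(3) by (intro colours Diff_dsubsets) (simp_all add: dsubsets_def)
  next
    fix F a assume "\<And>g. g < r \<Longrightarrow> F g \<subseteq> {1..q} \<and> card (F g) = q - d \<and> f ({1..q} - F g) = a"
    then show "(\<Inter>g<r. F g) \<noteq> {}"
      using no_cover has_cover_if_Inter_empty[OF assms(3), of r F f a] by (auto simp: dsubsets_def)
  qed (simp_all add: assms(1))
  obtain a b where q: "q = c + a + b" and d: "d = c + a"
    using assms(2,3) by (metis le_Suc_ex)
  obtain t where t: "r = Suc t" using r_ge_2 by (cases r) auto
  show False using card_points_le bound by (simp add: q d t algebra_simps)
qed

lemma prime_p: "prime (p q d c)"
  and p_ge: "(real q - real c + 1) / (real d - real c + 1) \<le> real (p q d c)"
proof -
  define x where "x = (real q - real c + 1) / (real d - real c + 1)"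
  obtain s where "prime s" "s > nat \<lceil>x\<rceil>" using bigger_prime by blast
  then have "\<exists>s. prime s \<and> real s \<ge> real_of_int \<lceil>x\<rceil>" by (intro exI[of _ s]) linarith
  then have "prime (p q d c) \<and> real (p q d c) \<ge> real_of_int \<lceil>x\<rceil>"
    unfolding p_def x_def by (rule LeastI_ex)
  then show "prime (p q d c)" and "x \<le> real (p q d c)" by linarith+
qed

lemma less_p_mult:
  assumes "c \<le> d"
  shows "q < p q d c * (d - c + 1) + c"
proof -
  have "real q - real c + 1 \<le> real (p q d c) * real (d - c + 1)"
    using p_ge[of q c d] assms by (simp add: divide_le_eq of_nat_diff add.commute)
  then have "real (q + 1) \<le> real (p q d c * (d - c + 1) + c)"
    by (simp only: of_nat_add of_nat_mult of_nat_1)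
  then show ?thesis by (simp only: of_nat_le_iff)
qed

theorem theorem2p6:
  fixes q d c :: nat
  assumes "1 \<le> c" and "c \<le> d" and "d \<le> q"
  shows "(\<forall>f :: nat set \<Rightarrow> nat. (\<forall>S\<in>dsubsets q d. f S \<in> {1..c}) \<longrightarrow> has_cover q d f (p q d c))
         \<and> B q d c \<le> p q d c"
proof -
  have cover: "has_cover q d f (p q d c)" if "\<forall>S\<in>dsubsets q d. f S \<in> {1..c}" for f
    by (rule has_cover_if_prime[OF prime_p assms(2,3) less_p_mult[OF assms(2)]]) (use that in blast)
  moreover have "B q d c \<le> p q d c" unfolding B_def by (rule Least_le) (use cover in blast)
  ultimately show ?thesis by blast
qed

end
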